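(* Let $m\ge 2$ and let $A$ be a symmetric $2m\times 2m$ $(0,1)$-matrix with zero diagonal (the adjacency matrix of a graph on $2m$ vertices). Partition $A$ into $2\times 2$ blocks and write $A_{i,j}$ ($1\le i,j\le m$) for the $(i,j)$-th block, so that $A_{j,i}=A_{i,j}^T$. Let $$X_1=\begin{bmatrix}-1&1\\ 1&-1\\ 1&1\\ 1&1\end{bmatrix}=\begin{bmatrix}J-2I\\ J\end{bmatrix},$$ where $J$ and $I$ are the $2\times 2$ all-ones and identity matrices, and for $i=1,\dots,m-1$ let $$M_i=\begin{bmatrix}A_{i,i}&A_{i,i+1}\\ A_{i,i+1}^T&A_{i+1,i+1}\end{bmatrix}.$$ Then $\frac14 X_1^TM_iX_1$ is a $(0,1)$-matrix for every $i=1,\dots,m-1$ if and only if both of the following hold: (a) either $A_{1,1}=A_{2,2}=\cdots=A_{m,m}=\begin{bmatrix}0&0\\0&0\end{bmatrix}$, or $A_{1,1}=A_{2,2}=\cdots=A_{m,m}=\begin{bmatrix}0&1\\1&0\end{bmatrix}$; (b) for each $i=1,\dots,m-1$, the block $A_{i,i+1}$ is one of the six matrices $$\begin{bmatrix}0&0\\0&0\end{bmatrix},\ \begin{bmatrix}1&0\\1&0\end{bmatrix},\ \begin{bmatrix}1&0\\0&1\end{bmatrix},\ \begin{bmatrix}1&1\\1&1\end{bmatrix},\ \begin{bmatrix}0&1\\0&1\end{bmatrix},\ \begin{bmatrix}0&1\\1&0\end{bmatrix}.$$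
   Context: A $(0,1)$-matrix is a matrix all of whose entries are $0$ or $1$. The matrix $X_1$ records the $2\times 2$-block structure relevant to the regular rational orthogonal matrix of level two $Q_{2m}=\frac12\,(\text{block matrix with } J-2I \text{ on the diagonal blocks, } J \text{ on blocks } (i+1,i) \text{ and on block } (1,m), \text{ zero elsewhere})$. *)

theory Defs
  imports Complex_Main "Jordan_Normal_Form.Matrix" "Jordan_Normal_Form.DL_Submatrix"
begin

definition zero_one_mat :: "real mat \<Rightarrow> bool" where
  "zero_one_mat A \<longleftrightarrow> elements_mat A \<subseteq> {0, 1}"

(* Block indices start at 1, whereas entry indices of the matrix library start at 0. *)
definition block :: "real mat \<Rightarrow> nat \<Rightarrow> nat \<Rightarrow> real mat" where
  "block A i j = submatrix A {2 * (i - 1)..<2 * i} {2 * (j - 1)..<2 * j}"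

definition J2 :: "real mat" where
  "J2 = mat 2 2 (\<lambda>_. 1)"

definition X1 :: "real mat" where
  "X1 = (J2 - 2 \<cdot>\<^sub>m 1\<^sub>m 2) @\<^sub>r J2"

definition block_pair :: "real mat \<Rightarrow> nat \<Rightarrow> real mat" where
  "block_pair A i = four_block_mat (block A i i) (block A i (i + 1))
     (transpose_mat (block A i (i + 1))) (block A (i + 1) (i + 1))"

definition mat2 :: "real \<Rightarrow> real \<Rightarrow> real \<Rightarrow> real \<Rightarrow> real mat" where
  "mat2 a b c d = mat_of_rows_list 2 [[a, b], [c, d]]"

lemma X1_rows: "X1 = mat_of_rows_list 2 [[- 1, 1], [1, - 1], [1, 1], [1, 1]]"
  by (rule eq_matI)
    (auto simp: X1_def J2_def append_rows_def mat_of_rows_list_def less_Suc_eq numeral_eq_Suc)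

lemma block_eq:
  assumes A: "A \<in> carrier_mat (2 * m) (2 * m)" and i: "i \<in> {1..m}" and j: "j \<in> {1..m}"
  shows "block A i j = mat 2 2 (\<lambda>(r, s). A $$ (2 * (i - 1) + r, 2 * (j - 1) + s))"
proof -
  have S: "{a. a < 2 * m \<and> a \<in> {2 * (k - 1)..<2 * k}} = {2 * (k - 1)..<2 * k}"
    if "k \<in> {1..m}" for k using that by auto
  have C: "card {2 * (k - 1)..<2 * k} = 2" if "k \<in> {1..m}" for k :: nat using that by auto
  have P: "card {a \<in> {2 * (k - 1)..<2 * k}. a < 2 * (k - 1) + r} = r"
    if "k \<in> {1..m}" "r < 2" for k r :: nat
  proof -
    have "{a \<in> {2 * (k - 1)..<2 * k}. a < 2 * (k - 1) + r} = {2 * (k - 1)..<2 * (k - 1) + r}"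
      using that by auto
    then show ?thesis by simp
  qed
  have d: "dim_row A = 2 * m" "dim_col A = 2 * m" using A by auto
  show ?thesis
  proof (rule eq_matI)
    fix r s
    assume "r < dim_row (mat 2 2 (\<lambda>(r, s). A $$ (2 * (i - 1) + r, 2 * (j - 1) + s)))"
      "s < dim_col (mat 2 2 (\<lambda>(r, s). A $$ (2 * (i - 1) + r, 2 * (j - 1) + s)))"
    then have r: "r < 2" and s: "s < 2" by auto
    have "2 * (i - 1) + r < dim_row A" "2 * (j - 1) + s < dim_col A"
      "2 * (i - 1) + r \<in> {2 * (i - 1)..<2 * i}" "2 * (j - 1) + s \<in> {2 * (j - 1)..<2 * j}"
      using d r s i j by auto
    from submatrix_index_card[OF this]
    have "block A i j $$ (r, s) = A $$ (2 * (i - 1) + r, 2 * (j - 1) + s)"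
      unfolding block_def P[OF i r] P[OF j s] .
    then show "block A i j $$ (r, s) = mat 2 2 (\<lambda>(r, s). A $$ (2 * (i - 1) + r, 2 * (j - 1) + s)) $$ (r, s)"
      using r s by simp
  qed (simp_all only: block_def dim_submatrix d S[OF i] S[OF j] C[OF i] C[OF j] dim_row_mat dim_col_mat)
qed

end

theory Submission
  imports Defs
begin

text \<open>
  For diagonal blocks with off-diagonal entries \<open>x\<close> and \<open>y\<close> and off-diagonal block with rows
  \<open>(a, b)\<close> and \<open>(c, d)\<close>, the matrix of the statement has off-diagonal entries \<open>(x + y) / 2\<close>,
  which forces \<open>x = y\<close>; its diagonal entries are then opposite to each other, which forces
  \<open>a + b = c + d\<close>. The six matrices are those \<open>(0,1)\<close>-matrices with equal row sums.
\<close>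

text \<open>The indices appear as \<open>Suc 0\<close> because the simplifier normalises the natural
  number 1 to this form.\<close>

lemma mat2_index:
  "mat2 a b c d $$ (0, 0) = a" "mat2 a b c d $$ (0, Suc 0) = b"
  "mat2 a b c d $$ (Suc 0, 0) = c" "mat2 a b c d $$ (Suc 0, Suc 0) = d"
  by (simp_all add: mat2_def mat_of_rows_list_def)

lemma dim_mat2 [simp]: "dim_row (mat2 a b c d) = 2" "dim_col (mat2 a b c d) = 2"
  by (simp_all add: mat2_def mat_of_rows_list_def)

lemma eq_mat2I:
  assumes "dim_row M = 2" "dim_col M = 2" "M $$ (0, 0) = a" "M $$ (0, Suc 0) = b"
    "M $$ (Suc 0, 0) = c" "M $$ (Suc 0, Suc 0) = d"
  shows "M = mat2 a b c d"
  by (rule eq_matI) (use assms in \<open>auto simp: mat2_index less_2_cases_iff\<close>)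

lemma mat2_eq_iff: "mat2 a b c d = mat2 a' b' c' d' \<longleftrightarrow> a = a' \<and> b = b' \<and> c = c' \<and> d = d'"
  by (metis mat2_index)

lemma transpose_mat2: "transpose_mat (mat2 a b c d) = mat2 a c b d"
  by (rule eq_mat2I) (simp_all add: mat2_index)

lemma zero_one_mat_iff:
  "zero_one_mat M \<longleftrightarrow> (\<forall>r<dim_row M. \<forall>s<dim_col M. M $$ (r, s) \<in> {0, 1})"
  unfolding zero_one_mat_def by (fastforce intro: elements_matI[OF carrier_matI[OF refl refl]])

lemma zero_one_mat2_iff:
  "zero_one_mat (mat2 a b c d) \<longleftrightarrow> a \<in> {0, 1} \<and> b \<in> {0, 1} \<and> c \<in> {0, 1} \<and> d \<in> {0, 1}"
  by (auto simp: zero_one_mat_iff mat2_index less_2_cases_iff)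

lemma dim_X1 [simp]: "dim_row X1 = 4" "dim_col X1 = 2"
  by (simp_all add: X1_rows mat_of_rows_list_def)

lemma X1_index:
  "X1 $$ (0, 0) = -1" "X1 $$ (0, Suc 0) = 1"
  "X1 $$ (Suc 0, 0) = 1" "X1 $$ (Suc 0, Suc 0) = -1"
  "X1 $$ (2, 0) = 1" "X1 $$ (2, Suc 0) = 1"
  "X1 $$ (3, 0) = 1" "X1 $$ (3, Suc 0) = 1"
  by (simp_all add: X1_rows mat_of_rows_list_def)

text \<open>With s = (1, -1) and e = (1, 1), the columns of \<open>X1\<close> are (-s, e) and (s,
  e). In the mixed product the two contributions of the off-diagonal block cancel; in the two
  squares they enter with opposite signs.\<close>

lemma X1_congruence:
  "(1 / 4) \<cdot>\<^sub>m (transpose_mat X1 *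
      four_block_mat (mat2 0 x x 0) (mat2 a b c d) (transpose_mat (mat2 a b c d)) (mat2 0 y y 0) * X1)
    = mat2 ((y - x + (c + d - a - b)) / 2) ((x + y) / 2)
        ((x + y) / 2) ((y - x - (c + d - a - b)) / 2)"
proof -
  have sum4: "(\<Sum>k = 0..<4. f k) = f 0 + f (Suc 0) + f 2 + f 3" for f :: "nat \<Rightarrow> real"
    by (simp add: eval_nat_numeral)
  show ?thesis
    by (rule eq_mat2I)
      (simp_all add: scalar_prod_def sum4 X1_index mat2_index transpose_mat2
        field_simps)
qed

lemma block_eq_mat2:
  assumes "A \<in> carrier_mat (2 * m) (2 * m)" "i \<in> {1..m}" "j \<in> {1..m}"
  shows "block A i j = mat2
    (A $$ (2 * (i - 1), 2 * (j - 1))) (A $$ (2 * (i - 1), 2 * (j - 1) + 1))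
    (A $$ (2 * (i - 1) + 1, 2 * (j - 1))) (A $$ (2 * (i - 1) + 1, 2 * (j - 1) + 1))"
  unfolding block_eq[OF assms] by (rule eq_mat2I) simp_all

lemma zero_one_mat_block:
  assumes "zero_one_mat A" "A \<in> carrier_mat (2 * m) (2 * m)" "i \<in> {1..m}" "j \<in> {1..m}"
  shows "zero_one_mat (block A i j)"
proof -
  have "2 * (k - 1) + r < 2 * m" if "k \<in> {1..m}" "r < 2" for k r :: nat
    using that by auto
  then have "A $$ (2 * (i - 1) + r, 2 * (j - 1) + s) \<in> {0, 1}" if "r < 2" "s < 2" for r s
    using assms that unfolding zero_one_mat_iff by (metis carrier_matD)
  then show ?thesis
    unfolding block_eq[OF assms(2-4)] zero_one_mat_iff by simp
qed

text \<open>Symmetry identifies the two off-diagonal entries, so a diagonal block has only one free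
  entry.\<close>

lemma diagonal_block:
  assumes A: "A \<in> carrier_mat (2 * m) (2 * m)" and sym: "transpose_mat A = A"
    and "zero_one_mat A" and diag: "\<forall>k<2 * m. A $$ (k, k) = 0" and i: "i \<in> {1..m}"
  obtains x where "x \<in> {0, 1}" "block A i i = mat2 0 x x 0"
proof -
  let ?k = "2 * (i - 1)"
  have k: "?k < 2 * m" "?k + 1 < 2 * m" using i by auto
  have "A $$ (?k + 1, ?k) = transpose_mat A $$ (?k, ?k + 1)" using A k by simp
  also have "\<dots> = A $$ (?k, ?k + 1)" using sym by simp
  finally have "block A i i = mat2 0 (A $$ (?k, ?k + 1)) (A $$ (?k, ?k + 1)) 0"
    using block_eq_mat2[OF A i i] diag k by simp
  moreover have "A $$ (?k, ?k + 1) \<in> {0, 1}"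
    using \<open>zero_one_mat A\<close> A k by (auto simp: zero_one_mat_iff)
  ultimately show thesis using that by blast
qed

text \<open>This is the condition for a single \<open>i\<close>; it compares neighbouring diagonal
  blocks only, and the theorem chains these comparisons.\<close>

lemma zero_one_mat_block_pair_iff:
  assumes A: "A \<in> carrier_mat (2 * m) (2 * m)" "transpose_mat A = A"
    "zero_one_mat A" "\<forall>k<2 * m. A $$ (k, k) = 0" and i: "i \<in> {1..m - 1}"
  shows "zero_one_mat ((1 / 4) \<cdot>\<^sub>m (transpose_mat X1 * block_pair A i * X1)) \<longleftrightarrow>
    block A i i = block A (i + 1) (i + 1) \<and>
    block A i (i + 1) \<in>
      {mat2 0 0 0 0, mat2 1 0 1 0, mat2 1 0 0 1, mat2 1 1 1 1, mat2 0 1 0 1, mat2 0 1 1 0}"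
proof -
  have i': "i \<in> {1..m}" "i + 1 \<in> {1..m}" using i by auto
  obtain x where x: "x \<in> {0, 1}" "block A i i = mat2 0 x x 0"
    using diagonal_block[OF A i'(1)] .
  obtain y where y: "y \<in> {0, 1}" "block A (i + 1) (i + 1) = mat2 0 y y 0"
    using diagonal_block[OF A i'(2)] .
  obtain a b c d where B: "block A i (i + 1) = mat2 a b c d"
    using block_eq_mat2[OF A(1) i'] by blast
  have abcd: "a \<in> {0, 1}" "b \<in> {0, 1}" "c \<in> {0, 1}" "d \<in> {0, 1}"
    using zero_one_mat_block[OF A(3,1) i'] unfolding B zero_one_mat2_iff by auto
  show ?thesis
    \<comment> \<open>Everything now depends on six numbers from {0, 1}, and the 64 cases are
      checked by arithmetic.\<close>
    unfolding block_pair_def x y B X1_congruence zero_one_mat2_iff insert_iff empty_iff mat2_eq_iff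
    using x(1) y(1) abcd by (elim insertE emptyE) simp_all
qed

theorem theorem3p2:
  fixes m :: nat and A :: "real mat"
  assumes "m \<ge> 2"
    and "A \<in> carrier_mat (2 * m) (2 * m)"
    and "transpose_mat A = A"
    and "zero_one_mat A"
    and "\<forall>k<2 * m. A $$ (k, k) = 0"
  shows "(\<forall>i\<in>{1..m - 1}. zero_one_mat ((1 / 4) \<cdot>\<^sub>m (transpose_mat X1 * block_pair A i * X1))) \<longleftrightarrow>
    ((\<forall>i\<in>{1..m}. block A i i = mat2 0 0 0 0) \<or> (\<forall>i\<in>{1..m}. block A i i = mat2 0 1 1 0)) \<and>
    (\<forall>i\<in>{1..m - 1}. block A i (i + 1) \<in>
      {mat2 0 0 0 0, mat2 1 0 1 0, mat2 1 0 0 1, mat2 1 1 1 1, mat2 0 1 0 1, mat2 0 1 1 0})"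
proof -
  note A = assms(2-5)
  have "(\<forall>i\<in>{1..m - 1}. block A i i = block A (i + 1) (i + 1)) \<longleftrightarrow>
    (\<forall>i\<in>{1..m}. block A i i = mat2 0 0 0 0) \<or> (\<forall>i\<in>{1..m}. block A i i = mat2 0 1 1 0)"
    (is "?L \<longleftrightarrow> ?R")
  proof
    assume L: ?L
    \<comment> \<open>The induction starts at 1; its step from \<open>n\<close> has
      \<open>Suc n \<le> m\<close>, so \<open>n\<close> stays in the range \<open>{1..m - 1}\<close>
      of \<open>?L\<close>.\<close>
    have const: "block A i i = block A 1 1" if "1 \<le> i" "i \<le> m" for i
      using that
    proof (induction i rule: dec_induct)
      case (step n)
      then have "n \<in> {1..m - 1}" by auto
      with L step show ?case by simp
    qed simp
    \<comment> \<open>The free entry of the first block selects the alternative in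
      \<open>?R\<close>: 0 gives the left one, 1 the right one.\<close>
    have "1 \<in> {1..m}" using assms(1) by simp
    then obtain x where "x \<in> {0, 1}" "block A 1 1 = mat2 0 x x 0"
      using diagonal_block[OF A] by blast
    with const show ?R by auto
  next
    assume ?R
    moreover have "i \<in> {1..m}" "i + 1 \<in> {1..m}" if "i \<in> {1..m - 1}" for i
      using that by auto
    ultimately show ?L by metis
  qed
  \<comment> \<open>The quantifier over \<open>i\<close> distributes over the conjunction of the
    local criterion, and the equivalence just shown rewrites the first conjunct.\<close>
  then show ?thesis
    using zero_one_mat_block_pair_iff[OF A] by (simp only: ball_conj_distrib cong: ball_cong)
qed

end
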